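(* Let $q$ be a positive integer and let $B_q=(S(m,n;q))_{m,n=1}^q$ be the $q\times q$ matrix whose $(m,n)$ entry is the Kloosterman sum $S(m,n;q)$. Then the characteristic polynomial of $B_q$ is \[ \det(\lambda E_q-B_q)=\lambda^{q-\varphi(q)}(\lambda-q)^{\frac{\varphi(q)+\widetilde{\varphi}(q)}{2}}(\lambda+q)^{\frac{\varphi(q)-\widetilde{\varphi}(q)}{2}}. \] In particular, $B_q$ has eigenvalues $0,q,-q$ with multiplicities $q-\varphi(q)$, $\frac{\varphi(q)+\widetilde{\varphi}(q)}{2}$, $\frac{\varphi(q)-\widetilde{\varphi}(q)}{2}$, respectively.
   Context: For positive integer $q$ and integers $m,n$, the Kloosterman sum is $S(m,n;q)=\sum_{1\le k\le q,\ \gcd(k,q)=1}\exp\bigl(\frac{2\pi i}{q}(mk+nk^* )\bigr)$, where $k^*$ denotes an inverse of $k$ modulo $q$. $\varphi$ is Euler's totient function, and $\widetilde{\varphi}(q)=\#\{1\le k\le q:\ \gcd(k,q)=1,\ k+k^*\equiv 0 \pmod q\}$ (equivalently, the number of $1\le k\le q$ coprime to $q$ with $k^2\equiv -1\pmod q$). $E_q$ is the $q\times q$ identity matrix. *)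

theory Defs
  imports
    "Jordan_Normal_Form.Char_Poly"
    "HOL-Number_Theory.Totient"
    "HOL-Number_Theory.Modular_Inverse"
begin

definition kloosterman :: "int \<Rightarrow> int \<Rightarrow> nat \<Rightarrow> complex" where
  "kloosterman m n q =
     (\<Sum>k \<in> {k \<in> {1..q}. coprime k q}.
        exp (2 * complex_of_real pi * \<i> / of_nat q *
             of_int (m * int k + n * modular_inverse (int q) (int k))))"

definition totient_tilde :: "nat \<Rightarrow> nat" where
  "totient_tilde q =
     card {k \<in> {1..q}. coprime k q \<and>
             [int k + modular_inverse (int q) (int k) = 0] (mod int q)}"

text \<open>Matrices are indexed from 0, so position \<open>(i, j)\<close> holds \<open>S(i + 1, j + 1; q)\<close>.\<close>

definition kloosterman_mat :: "nat \<Rightarrow> complex mat" where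
  "kloosterman_mat q = mat q q (\<lambda>(i, j). kloosterman (int i + 1) (int j + 1) q)"

end

theory Submission
  imports Defs "Jordan_Normal_Form.Schur_Decomposition"
begin

text \<open>
  With \<open>F = (e(mk/q))\<close>, summing the geometric series over \<open>n\<close> gives
  \<open>B\<^sub>q F = F N\<close>, where \<open>N\<close> has entry \<open>q\<close> at \<open>(k, l)\<close> if \<open>kl \<equiv> -1 (mod q)\<close>
  and \<open>0\<close> otherwise. Since \<open>F\<close> is invertible, \<open>B\<^sub>q\<close> is similar to \<open>N\<close>.
  As \<open>k \<mapsto> -k\<^sup>*\<close> is an involution of the units, \<open>N\<^sup>2\<close> is diagonal with entry \<open>q\<^sup>2\<close> at the
  units and \<open>0\<close> elsewhere, so the eigenvalues of \<open>N\<close> lie in \<open>{0, q, -q}\<close>. Their multiplicities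
  are determined by the dimension \<open>q\<close> and the traces of \<open>N\<close> and \<open>N\<^sup>2\<close>: the units fixed by the
  involution are counted by \<open>totient_tilde\<close>, all units by \<open>totient\<close>.
\<close>

section \<open>Traces and characteristic polynomials\<close>

definition mat_trace :: "'a :: comm_monoid_add mat \<Rightarrow> 'a" where
  "mat_trace A = (\<Sum>i<dim_row A. A $$ (i, i))"

lemma mat_trace_conv_diag_mat: "mat_trace A = sum_list (diag_mat A)"
  by (simp add: mat_trace_def diag_mat_def sum_list_distinct_conv_sum_set lessThan_atLeast0)

lemma mat_trace_mult_commute:
  fixes A B :: "'a :: comm_semiring_0 mat"
  assumes A: "A \<in> carrier_mat n n" and B: "B \<in> carrier_mat n n"
  shows "mat_trace (A * B) = mat_trace (B * A)"
proof -
  have "mat_trace (A * B) = (\<Sum>i<n. \<Sum>j<n. A $$ (i, j) * B $$ (j, i))"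
    using A B by (simp add: mat_trace_def scalar_prod_def lessThan_atLeast0)
  also have "\<dots> = (\<Sum>j<n. \<Sum>i<n. B $$ (j, i) * A $$ (i, j))"
    by (subst sum.swap) (simp add: mult.commute)
  also have "\<dots> = mat_trace (B * A)"
    using A B by (simp add: mat_trace_def scalar_prod_def lessThan_atLeast0)
  finally show ?thesis .
qed

lemma mat_trace_similar:
  fixes A B :: "'a :: comm_ring_1 mat"
  assumes "similar_mat A B"
  shows "mat_trace A = mat_trace B"
proof -
  from similar_matD[OF assms] obtain n P Q where
    carr: "A \<in> carrier_mat n n" "B \<in> carrier_mat n n" "P \<in> carrier_mat n n" "Q \<in> carrier_mat n n"
    and QP: "Q * P = 1\<^sub>m n" and eq: "A = P * B * Q"
    by auto
  have "mat_trace A = mat_trace (P * (B * Q))"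
    unfolding eq using carr by (simp add: assoc_mult_mat[of P n n B n Q n])
  also have "\<dots> = mat_trace (B * Q * P)"
    using carr by (intro mat_trace_mult_commute[of _ n]) auto
  also have "B * Q * P = B"
    using carr QP by (simp add: assoc_mult_mat[of B n n Q n P n])
  finally show ?thesis .
qed

text \<open>In the sum over j of \<open>B $$ (i, j) * B $$ (j, i)\<close>, one factor lies below the
  diagonal unless j = i.\<close>

lemma upper_triangular_square_diag:
  fixes B :: "'a :: comm_semiring_1 mat"
  assumes B: "B \<in> carrier_mat n n" and ut: "upper_triangular B" and i: "i < n"
  shows "(B * B) $$ (i, i) = (B $$ (i, i))\<^sup>2"
proof -
  have "(B * B) $$ (i, i) = (\<Sum>j<n. B $$ (i, j) * B $$ (j, i))"
    using B i by (simp add: scalar_prod_def lessThan_atLeast0)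
  also have "\<dots> = (\<Sum>j<n. if j = i then (B $$ (i, i))\<^sup>2 else 0)"
  proof (intro sum.cong refl)
    fix j assume "j \<in> {..<n}"
    thus "B $$ (i, j) * B $$ (j, i) = (if j = i then (B $$ (i, i))\<^sup>2 else 0)"
      using upper_triangularD[OF ut, of j i] upper_triangularD[OF ut, of i j] B i
      by (cases j i rule: linorder_cases) (auto simp: power2_eq_square)
  qed
  also have "\<dots> = (B $$ (i, i))\<^sup>2"
    using i by simp
  finally show ?thesis .
qed

text \<open>A Schur decomposition makes A similar to an upper triangular matrix with diagonal
  \<open>es\<close>. The same change of basis works for the squares, so both traces can be read off
  that diagonal.\<close>

lemma mat_trace_eigenvalues:
  fixes A :: "complex mat"
  assumes A: "A \<in> carrier_mat n n" and cp: "char_poly A = (\<Prod>a\<leftarrow>es. [:- a, 1:])"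
  shows "mat_trace A = sum_list es"
    and "mat_trace (A * A) = (\<Sum>a\<leftarrow>es. a\<^sup>2)"
proof -
  obtain B P Q where "schur_decomposition A es = (B, P, Q)"
    by (cases "schur_decomposition A es") auto
  from schur_decomposition[OF A cp this] have
    wit: "similar_mat_wit A B P Q" and ut: "upper_triangular B" and diag: "diag_mat B = es"
    by auto
  from similar_mat_witD2[OF A wit] have B: "B \<in> carrier_mat n n" by auto
  have "similar_mat A B"
    using wit unfolding similar_mat_def by blast
  thus "mat_trace A = sum_list es"
    using mat_trace_similar mat_trace_conv_diag_mat[of B] diag by metis
  have "similar_mat (A ^\<^sub>m 2) (B ^\<^sub>m 2)"
    using similar_mat_wit_pow[OF wit, of 2] unfolding similar_mat_def by blast
  hence "mat_trace (A * A) = mat_trace (B * B)"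
    using A B mat_trace_similar[of "A ^\<^sub>m 2" "B ^\<^sub>m 2"]
    by (simp add: numeral_2_eq_2)
  also have "\<dots> = (\<Sum>i<n. (B $$ (i, i))\<^sup>2)"
    using B by (auto simp: mat_trace_def upper_triangular_square_diag[OF B ut] intro!: sum.cong
      simp del: index_mult_mat(1))
  also have "\<dots> = (\<Sum>a\<leftarrow>diag_mat B. a\<^sup>2)"
    using B by (simp add: diag_mat_def o_def sum_list_distinct_conv_sum_set lessThan_atLeast0)
  finally show "mat_trace (A * A) = (\<Sum>a\<leftarrow>es. a\<^sup>2)"
    by (simp add: diag)
qed

section \<open>Multiplicities of the eigenvalues 0, c, -c from two traces\<close>

lemma linear_factors_three_roots:
  fixes c :: complex
  assumes "set es \<subseteq> {0, c, - c}"
  shows "\<exists>a b d. (\<Prod>x\<leftarrow>es. [:- x, 1:]) = [:0, 1:] ^ a * [:- c, 1:] ^ b * [:c, 1:] ^ d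
     \<and> length es = a + b + d
     \<and> sum_list es = c * (of_nat b - of_nat d)
     \<and> (\<Sum>x\<leftarrow>es. x\<^sup>2) = c\<^sup>2 * (of_nat b + of_nat d)"
  using assms
proof (induction es)
  case Nil
  show ?case by (intro exI[of _ 0]) simp
next
  case (Cons x es)
  then obtain a b d where
    IH: "(\<Prod>x\<leftarrow>es. [:- x, 1:]) = [:0, 1:] ^ a * [:- c, 1:] ^ b * [:c, 1:] ^ d"
        "length es = a + b + d" "sum_list es = c * (of_nat b - of_nat d)"
        "(\<Sum>x\<leftarrow>es. x\<^sup>2) = c\<^sup>2 * (of_nat b + of_nat d)"
    by auto
  from Cons.prems consider "x = 0" | "x = c" | "x = - c" by auto
  thus ?case
  proof cases
    case 1
    show ?thesis
      by (intro exI[of _ "Suc a"] exI[of _ b] exI[of _ d])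
         (simp only: list.map prod_list.Cons sum_list.Cons IH 1, simp add: IH mult_ac)
  next
    case 2
    show ?thesis
      by (intro exI[of _ a] exI[of _ "Suc b"] exI[of _ d])
         (simp only: list.map prod_list.Cons sum_list.Cons IH 2 power_Suc, 
          simp add: IH algebra_simps del: mult_pCons_left mult_pCons_right)
  next
    case 3
    show ?thesis
      by (intro exI[of _ a] exI[of _ b] exI[of _ "Suc d"])
         (simp only: list.map prod_list.Cons sum_list.Cons IH 3 power_Suc, 
          simp add: IH algebra_simps del: mult_pCons_left mult_pCons_right)
  qed
qed

text \<open>For nonzero c, the two traces give b - d and b + d, and the dimension then gives a.
  Multiplicities are thus obtained without computing any eigenspace.\<close>

lemma char_poly_three_eigenvalues:
  fixes A :: "complex mat"
  assumes A: "A \<in> carrier_mat n n" and ev: "\<And>x. eigenvalue A x \<Longrightarrow> x \<in> {0, c, - c}"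
  obtains a b d where "char_poly A = [:0, 1:] ^ a * [:- c, 1:] ^ b * [:c, 1:] ^ d"
    "a + b + d = n"
    "mat_trace A = c * (of_nat b - of_nat d)"
    "mat_trace (A * A) = c\<^sup>2 * (of_nat b + of_nat d)"
proof -
  from char_poly_factorized[OF A] obtain es where
    cp: "char_poly A = (\<Prod>a\<leftarrow>es. [:- a, 1:])" and len: "length es = n" by blast
  have "set es \<subseteq> {0, c, - c}"
  proof
    fix x assume "x \<in> set es"
    hence "poly (char_poly A) x = 0"
      unfolding cp poly_prod_list by (auto simp: prod_list_zero_iff)
    thus "x \<in> {0, c, - c}"
      using ev eigenvalue_root_char_poly[OF A] by blast
  qed
  from linear_factors_three_roots[OF this] that len cp mat_trace_eigenvalues[OF A cp]
  show ?thesis by metis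
qed

lemma order_linear_power:
  fixes x y :: "'a :: field"
  shows "Polynomial.order x ([:- y, 1:] ^ k) = (if x = y then k else 0)"
proof (cases "x = y")
  case True
  thus ?thesis by (simp add: order_power_n_n)
next
  case False
  thus ?thesis by (auto intro!: order_0I)
qed

text \<open>The order of a root is additive over products of nonzero polynomials, and 0, c, -c are
  distinct because c is nonzero and the characteristic is 0.\<close>

lemma order_three_roots:
  fixes c :: "'a :: field_char_0"
  assumes c: "c \<noteq> 0" and p: "p = [:0, 1:] ^ a * [:- c, 1:] ^ b * [:c, 1:] ^ d"
  shows "Polynomial.order 0 p = a" "Polynomial.order c p = b" "Polynomial.order (- c) p = d"
proof -
  have "p \<noteq> 0" unfolding p by simp
  hence ord: "Polynomial.order x p = Polynomial.order x ([:- 0, 1:] ^ a)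
    + Polynomial.order x ([:- c, 1:] ^ b) + Polynomial.order x ([:- (- c), 1:] ^ d)" for x
    unfolding p by (simp add: order_mult)
  show "Polynomial.order 0 p = a" "Polynomial.order c p = b" "Polynomial.order (- c) p = d"
    unfolding ord order_linear_power using c by auto
qed

section \<open>The discrete Fourier transform\<close>

text \<open>The standard additive character of the integers modulo q, usually written
  e(t/q).\<close>

definition add_char :: "nat \<Rightarrow> int \<Rightarrow> complex" where
  "add_char q t = exp (2 * complex_of_real pi * \<i> / of_nat q * of_int t)"

lemma add_char_add: "add_char q (s + t) = add_char q s * add_char q t"
  by (simp add: add_char_def exp_add ring_distribs)

lemma add_char_power: "add_char q (int n * t) = add_char q t ^ n"
  by (simp add: add_char_def exp_of_nat_mult[symmetric] mult_ac)

lemma add_char_eq_1_iff: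
  assumes "q > 0"
  shows "add_char q t = 1 \<longleftrightarrow> int q dvd t"
proof -
  have arg: "2 * complex_of_real pi * \<i> / of_nat q * of_int t = \<i> * complex_of_real (2 * pi * t / q)"
    by simp
  \<comment> \<open>The value lies on the unit circle, so its real part decides: cos = 1 forces sin
    = 0.\<close>
  have "add_char q t = 1 \<longleftrightarrow> cos (2 * pi * t / q) = 1"
    unfolding add_char_def arg cis_conv_exp[symmetric]
    by (auto simp: complex_eq_iff dest: cos_one_sin_zero)
  also have "\<dots> \<longleftrightarrow> (\<exists>k::int. 2 * pi * t / q = of_int (2 * k) * pi)"
    by (simp add: cos_one_2pi_int mult_ac)
  also have "\<dots> \<longleftrightarrow> (\<exists>k::int. t = int q * k)"
  proof (intro ex_cong1)
    fix k :: int
    have "2 * pi * t / q = of_int (2 * k) * pi \<longleftrightarrow> real_of_int t = real_of_int (int q * k)"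
      using assms by (simp add: field_simps)
    thus "2 * pi * t / q = of_int (2 * k) * pi \<longleftrightarrow> t = int q * k"
      by (simp only: of_int_eq_iff)
  qed
  finally show ?thesis by (simp add: dvd_def)
qed

text \<open>Orthogonality of characters: a geometric series over a full period. The shift n + 1 fits
  matrices indexed from 0 whose rows and columns stand for the residues 1, ..., q.\<close>

lemma sum_add_char:
  assumes q: "q > 0"
  shows "(\<Sum>n<q. add_char q ((int n + 1) * t)) = (if int q dvd t then of_nat q else 0)"
proof -
  have "(\<Sum>n<q. add_char q ((int n + 1) * t)) = add_char q t * (\<Sum>n<q. add_char q t ^ n)"
    by (simp add: distrib_right add_char_add add_char_power sum_distrib_left mult.commute[of "add_char q t"])
  also have "\<dots> = (if int q dvd t then of_nat q else 0)"
  proof (cases "int q dvd t")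
    case True
    thus ?thesis using add_char_eq_1_iff[OF q, of t] by simp
  next
    case False
    \<comment> \<open>The ratio is a q-th root of unity other than 1, so the geometric sum
      vanishes.\<close>
    have "add_char q t ^ q = 1"
      using add_char_eq_1_iff[OF q, of "int q * t"] by (simp add: add_char_power)
    thus ?thesis
      using False add_char_eq_1_iff[OF q, of t] by (simp add: geometric_sum)
  qed
  finally show ?thesis .
qed

text \<open>The sign s covers the Fourier matrix (s = 1) and its complex conjugate (s = -1) in one
  definition; the latter is q times the inverse of the former.\<close>

definition dft_mat :: "nat \<Rightarrow> int \<Rightarrow> complex mat" where
  "dft_mat q s = mat q q (\<lambda>(i, j). add_char q (s * (int i + 1) * (int j + 1)))"

lemma dft_mat_carrier [simp]: "dft_mat q s \<in> carrier_mat q q"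
  by (simp add: dft_mat_def)

lemma dvd_diff_imp_eq:
  assumes "i < q" "j < q" "int q dvd int i - int j"
  shows "i = j"
  using assms by (metis cong_iff_dvd_diff cong_int_iff cong_less_modulus_unique_nat)

text \<open>Character orthogonality, applied to the difference of the row and column index. Both
  signs are allowed so that one statement yields the left and the right inverse.\<close>

lemma dft_mat_mult:
  assumes q: "q > 0" and s: "s \<in> {1, -1}"
  shows "dft_mat q s * dft_mat q (- s) = of_nat q \<cdot>\<^sub>m 1\<^sub>m q"
proof (rule eq_matI)
  fix i j assume "i < dim_row (of_nat q \<cdot>\<^sub>m 1\<^sub>m q :: complex mat)"
    "j < dim_col (of_nat q \<cdot>\<^sub>m 1\<^sub>m q :: complex mat)"
  hence ij: "i < q" "j < q" by auto
  have "(dft_mat q s * dft_mat q (- s)) $$ (i, j)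
      = (\<Sum>n<q. add_char q (s * (int i + 1) * (int n + 1)) * add_char q (- s * (int n + 1) * (int j + 1)))"
    using ij by (simp add: dft_mat_def scalar_prod_def lessThan_atLeast0)
  also have "\<dots> = (\<Sum>n<q. add_char q ((int n + 1) * (s * (int i - int j))))"
    by (intro sum.cong refl, subst add_char_add[symmetric], rule arg_cong[of _ _ "add_char q"])
       (simp add: algebra_simps)
  also have "\<dots> = (if i = j then of_nat q else 0)"
  proof -
    have "int q dvd s * (int i - int j) \<longleftrightarrow> int q dvd int i - int j"
      using s dvd_minus_iff[of "int q" "int i - int j"] by auto
    also have "\<dots> \<longleftrightarrow> i = j"
      using dvd_diff_imp_eq[of i q j] ij by auto
    finally show ?thesis
      unfolding sum_add_char[OF q] by simp
  qed
  finally show "(dft_mat q s * dft_mat q (- s)) $$ (i, j) = (of_nat q \<cdot>\<^sub>m 1\<^sub>m q) $$ (i, j)"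
    using ij by simp
qed (auto simp: dft_mat_def)

section \<open>The Kloosterman matrix in the Fourier basis\<close>

text \<open>On the units this is q times the permutation matrix of the map sending k to minus its
  inverse; rows and columns of non-units vanish.\<close>

definition neg_inverse_mat :: "nat \<Rightarrow> complex mat" where
  "neg_inverse_mat q =
     mat q q (\<lambda>(i, j). if int q dvd (int i + 1) * (int j + 1) + 1 then of_nat q else 0)"

lemma neg_inverse_mat_carrier [simp]: "neg_inverse_mat q \<in> carrier_mat q q"
  by (simp add: neg_inverse_mat_def)

text \<open>A common divisor of a and q divides both \<open>a * b\<close> and
  \<open>a * b + 1\<close>.\<close>

lemma dvd_mult_add_1_imp_coprime:
  fixes q a b :: int
  assumes "q dvd a * b + 1"
  shows "coprime a q"
proof (rule coprimeI)
  fix c assume "c dvd a" "c dvd q"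
  hence "c dvd a * b" "c dvd a * b + 1"
    using assms by (auto intro: dvd_trans)
  thus "is_unit c" using dvd_add_right_iff by blast
qed

text \<open>Multiplying by the unit a preserves divisibility by q and turns the modular inverse into
  1.\<close>

lemma dvd_modular_inverse_add_iff:
  fixes q a b :: int
  assumes "coprime a q"
  shows "q dvd modular_inverse q a + b \<longleftrightarrow> q dvd a * b + 1"
proof -
  have *: "q dvd a * modular_inverse q a - 1"
    using cong_modular_inverse1[OF assms] by (simp add: cong_iff_dvd_diff)
  have "q dvd modular_inverse q a + b \<longleftrightarrow> q dvd a * (modular_inverse q a + b)"
    using assms by (simp add: coprime_dvd_mult_right_iff coprime_commute)
  also have "a * (modular_inverse q a + b) = (a * b + 1) + (a * modular_inverse q a - 1)"
    by (simp add: algebra_simps)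
  also have "q dvd \<dots> \<longleftrightarrow> q dvd a * b + 1"
    using * by (rule dvd_add_left_iff)
  finally show ?thesis .
qed

text \<open>The coprimality condition moves into the summand and the range is shifted to start at 0,
  which gives the shape of a matrix product and allows sums to be exchanged freely.\<close>

lemma kloosterman_conv_add_char:
  "kloosterman m n q = (\<Sum>k<q. if coprime (int k + 1) (int q)
     then add_char q (m * (int k + 1)) * add_char q (n * modular_inverse (int q) (int k + 1)) else 0)"
proof -
  have "kloosterman m n q = (\<Sum>k\<in>{1..q}. if coprime (int k) (int q)
     then add_char q (m * int k) * add_char q (n * modular_inverse (int q) (int k)) else 0)"
    unfolding kloosterman_def add_char_def[symmetric] add_char_add
    by (simp only: sum.inter_filter finite_atLeastAtMost coprime_int_iff)
  also have "{1..q} = Suc ` {..<q}"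
    by (simp add: image_Suc_lessThan)
  finally show ?thesis
    by (simp add: sum.reindex del: coprime_int_iff of_nat_Suc) (simp only: of_nat_Suc add.commute[of 1 "int _"])
qed

lemma kloosterman_mat_mult_dft_mat:
  assumes q: "q > 0"
  shows "kloosterman_mat q * dft_mat q 1 = dft_mat q 1 * neg_inverse_mat q"
proof (rule eq_matI)
  fix m l assume "m < dim_row (dft_mat q 1 * neg_inverse_mat q)"
    "l < dim_col (dft_mat q 1 * neg_inverse_mat q)"
  hence ml: "m < q" "l < q" by (auto simp: dft_mat_def neg_inverse_mat_def)
  let ?inv = "\<lambda>k. modular_inverse (int q) (int k + 1)"
  have "(kloosterman_mat q * dft_mat q 1) $$ (m, l)
      = (\<Sum>n<q. kloosterman (int m + 1) (int n + 1) q * add_char q ((int n + 1) * (int l + 1)))"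
    using ml by (simp add: kloosterman_mat_def dft_mat_def scalar_prod_def lessThan_atLeast0)
  also have "\<dots> = (\<Sum>n<q. \<Sum>k<q. if coprime (int k + 1) (int q)
      then add_char q ((int m + 1) * (int k + 1)) * add_char q ((int n + 1) * (?inv k + (int l + 1))) else 0)"
    unfolding kloosterman_conv_add_char sum_distrib_right
    by (intro sum.cong refl) (simp add: distrib_left[of _ "?inv _"] add_char_add)
  \<comment> \<open>After exchanging the sums, n occurs only in the second character, which runs
    over a full period.\<close>
  also have "\<dots> = (\<Sum>k<q. if coprime (int k + 1) (int q)
      then add_char q ((int m + 1) * (int k + 1)) * (\<Sum>n<q. add_char q ((int n + 1) * (?inv k + (int l + 1)))) else 0)"
    by (subst sum.swap) (auto intro!: sum.cong simp: sum_distrib_left)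
  also have "\<dots> = (\<Sum>k<q. add_char q ((int m + 1) * (int k + 1)) *
      (if int q dvd (int k + 1) * (int l + 1) + 1 then of_nat q else 0))"
    by (intro sum.cong refl)
       (auto simp only: sum_add_char[OF q] dvd_modular_inverse_add_iff mult_zero_right
         dest: dvd_mult_add_1_imp_coprime split: if_splits)
  also have "\<dots> = (dft_mat q 1 * neg_inverse_mat q) $$ (m, l)"
    using ml by (simp add: dft_mat_def neg_inverse_mat_def scalar_prod_def lessThan_atLeast0)
  finally show "(kloosterman_mat q * dft_mat q 1) $$ (m, l) = (dft_mat q 1 * neg_inverse_mat q) $$ (m, l)" .
qed (auto simp: dft_mat_def neg_inverse_mat_def kloosterman_mat_def)

lemma similar_kloosterman_mat:
  assumes q: "q > 0"
  shows "similar_mat (kloosterman_mat q) (neg_inverse_mat q)"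
proof (rule similar_matI)
  let ?F = "dft_mat q 1" and ?G = "(1 / of_nat q) \<cdot>\<^sub>m dft_mat q (-1)"
  have K: "kloosterman_mat q \<in> carrier_mat q q"
    by (simp add: kloosterman_mat_def)
  have F: "?F \<in> carrier_mat q q" and G: "?G \<in> carrier_mat q q" and F': "dft_mat q (-1) \<in> carrier_mat q q"
    by auto
  have one: "(1 / of_nat q) \<cdot>\<^sub>m (of_nat q \<cdot>\<^sub>m 1\<^sub>m q) = (1\<^sub>m q :: complex mat)"
    using q by (intro eq_matI) auto
  show "{kloosterman_mat q, neg_inverse_mat q, ?F, ?G} \<subseteq> carrier_mat q q"
    using K F G by auto
  show FG: "?F * ?G = 1\<^sub>m q"
    using dft_mat_mult[OF q, of 1] by (simp add: mult_smult_distrib[OF F F'] one)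
  show "?G * ?F = 1\<^sub>m q"
    using dft_mat_mult[OF q, of "-1"] by (simp add: mult_smult_assoc_mat[OF F' F] one)
  have "?F * neg_inverse_mat q * ?G = kloosterman_mat q * ?F * ?G"
    by (simp add: kloosterman_mat_mult_dft_mat[OF q])
  also have "\<dots> = kloosterman_mat q"
    unfolding assoc_mult_mat[OF K F G] FG using K by simp
  finally show "kloosterman_mat q = ?F * neg_inverse_mat q * ?G" ..
qed

section \<open>Negative inverses modulo q and the square of \<open>neg_inverse_mat\<close>\<close>

lemma ex_neg_inverse:
  assumes q: "q > 0" and i: "coprime (int i + 1) (int q)"
  shows "\<exists>j<q. int q dvd (int i + 1) * (int j + 1) + 1"
proof -
  \<comment> \<open>The residue wanted is \<open>t + 1\<close>, minus the inverse of
    \<open>i + 1\<close>; subtracting 1 before the reduction makes t a valid index below q.\<close>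
  define t where "t = (- modular_inverse (int q) (int i + 1) - 1) mod int q"
  have t: "t \<ge> 0" "t < int q" using q by (auto simp: t_def)
  have "int q dvd (- modular_inverse (int q) (int i + 1) - 1) - t"
    unfolding t_def by (rule dvd_minus_mod)
  also have "\<dots> = - (modular_inverse (int q) (int i + 1) + (t + 1))"
    by simp
  finally have "int q dvd modular_inverse (int q) (int i + 1) + (t + 1)"
    by (simp only: dvd_minus_iff)
  hence "int q dvd (int i + 1) * (t + 1) + 1"
    using dvd_modular_inverse_add_iff[OF i] by blast
  thus ?thesis using t by (intro exI[of _ "nat t"]) auto
qed

lemma neg_inverse_unique:
  assumes "i < q" "l < q" "int q dvd (int i + 1) * (int j + 1) + 1"
    "int q dvd (int j + 1) * (int l + 1) + 1"
  shows "i = l"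
proof -
  \<comment> \<open>This combination cancels the triple products and leaves l - i.\<close>
  have "int q dvd (int l + 1) * ((int i + 1) * (int j + 1) + 1) - (int i + 1) * ((int j + 1) * (int l + 1) + 1)"
    using assms by (intro dvd_diff dvd_mult) auto
  also have "\<dots> = int l - int i" by (simp add: algebra_simps)
  finally show ?thesis using dvd_diff_imp_eq[of l q i] assms by simp
qed

text \<open>Taking the negative inverse twice returns to the start, so for a unit exactly one
  intermediate index j contributes and it leads back to i. In all other cases no j
  contributes.\<close>

lemma neg_inverse_mat_square:
  assumes q: "q > 0" and il: "i < q" "l < q"
  shows "(neg_inverse_mat q * neg_inverse_mat q) $$ (i, l) =
    (if i = l \<and> coprime (int i + 1) (int q) then (of_nat q)\<^sup>2 else 0)"
proof -
  let ?D = "\<lambda>i j. int q dvd (int i + 1) * (int j + 1) + 1"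
  have "(neg_inverse_mat q * neg_inverse_mat q) $$ (i, l)
      = (\<Sum>j<q. (if ?D i j then of_nat q else 0) * (if ?D j l then of_nat q else 0))"
    using il by (simp add: neg_inverse_mat_def scalar_prod_def lessThan_atLeast0)
  also have "\<dots> = (\<Sum>j<q. if ?D i j \<and> ?D j l then (of_nat q)\<^sup>2 else 0)"
    by (intro sum.cong) (auto simp: power2_eq_square)
  also have "\<dots> = (if i = l \<and> coprime (int i + 1) (int q) then (of_nat q)\<^sup>2 else 0)"
  proof (cases "i = l \<and> coprime (int i + 1) (int q)")
    case True
    then obtain j0 where j0: "j0 < q" "?D i j0" using ex_neg_inverse[OF q] by blast
    have "?D i j \<and> ?D j l \<longleftrightarrow> j = j0" if "j < q" for j
    proof
      assume "?D i j \<and> ?D j l"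
      with j0 that show "j = j0" 
        using neg_inverse_unique[of j q j0 i] by (auto simp: mult.commute)
    next
      assume "j = j0"
      with j0 True show "?D i j \<and> ?D j l" by (auto simp: mult.commute)
    qed
    hence "(\<Sum>j<q. if ?D i j \<and> ?D j l then (of_nat q)\<^sup>2 else 0)
        = (\<Sum>j<q. if j = j0 then (of_nat q)\<^sup>2 else (0::complex))"
      by (intro sum.cong) auto
    also have "\<dots> = (of_nat q)\<^sup>2"
      using j0 by simp
    finally show ?thesis unfolding if_P[OF True] .
  next
    case False
    hence "\<not> (?D i j \<and> ?D j l)" for j
      using neg_inverse_unique[OF il] dvd_mult_add_1_imp_coprime by blast
    thus ?thesis unfolding if_not_P[OF False] by (simp only: if_False sum.neutral_const)
  qed
  finally show ?thesis .
qed

text \<open>An eigenvector of A for x is one of \<open>A * A\<close> for the square of x; compare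
  both sides at a nonzero coordinate.\<close>

lemma eigenvalue_square_diagonal:
  fixes A :: "'a :: field mat"
  assumes A: "A \<in> carrier_mat n n" and ev: "eigenvalue A x"
    and diag: "\<And>i j. i < n \<Longrightarrow> j < n \<Longrightarrow> (A * A) $$ (i, j) = (if i = j then d i else 0)"
  shows "\<exists>i<n. x\<^sup>2 = d i"
proof -
  from ev A obtain v where v: "v \<in> carrier_vec n" "v \<noteq> 0\<^sub>v n" and Av: "A *\<^sub>v v = x \<cdot>\<^sub>v v"
    unfolding eigenvalue_def eigenvector_def by auto
  have AAv: "(A * A) *\<^sub>v v = x\<^sup>2 \<cdot>\<^sub>v v"
    using A v by (simp add: assoc_mult_mat_vec[OF A A] Av mult_mat_vec smult_smult_assoc power2_eq_square)
  from v obtain i where i: "i < n" "v $ i \<noteq> 0"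
    by (metis carrier_vecD eq_vecI index_zero_vec)
  have "(C *\<^sub>v v) $ i = (\<Sum>j<n. C $$ (i, j) * v $ j)" if "C \<in> carrier_mat n n" for C
    using that v i by (simp add: scalar_prod_def lessThan_atLeast0)
  from this[OF mult_carrier_mat[OF A A]]
  have "((A * A) *\<^sub>v v) $ i = (\<Sum>j<n. (A * A) $$ (i, j) * v $ j)" .
  also have "\<dots> = (\<Sum>j<n. if j = i then d i * v $ i else 0)"
    using i by (intro sum.cong refl) (auto simp: diag simp del: index_mult_mat)
  also have "\<dots> = d i * v $ i"
    using i by simp
  finally have "x\<^sup>2 * v $ i = d i * v $ i"
    unfolding AAv using v i by simp
  thus ?thesis using i by auto
qed

lemma eigenvalue_neg_inverse_mat:
  assumes q: "q > 0" and ev: "eigenvalue (neg_inverse_mat q) x"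
  shows "x \<in> {0, of_nat q, - of_nat q}"
proof -
  have "\<exists>i<q. x\<^sup>2 = (if coprime (int i + 1) (int q) then (of_nat q)\<^sup>2 else 0)"
    by (rule eigenvalue_square_diagonal[OF neg_inverse_mat_carrier ev])
       (auto simp: neg_inverse_mat_square[OF q] simp del: index_mult_mat)
  thus ?thesis by (auto simp: power2_eq_iff split: if_splits)
qed

section \<open>The two traces of \<open>neg_inverse_mat\<close>\<close>

lemma card_filter_lessThan_Suc: "card {i \<in> {..<q}. P (Suc i)} = card {k \<in> {1..q}. P k}"
proof -
  have "{k \<in> {1..q}. P k} = Suc ` {i \<in> {..<q}. P (Suc i)}"
    by (auto simp: image_iff Bex_def) (metis Suc_le_D Suc_le_lessD)
  thus ?thesis by (simp add: card_image)
qed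

text \<open>A diagonal entry is nonzero exactly when the residue k is fixed by the negative inverse,
  that is, when k squared is -1 modulo q; such k are automatically units.\<close>

lemma mat_trace_neg_inverse_mat:
  "mat_trace (neg_inverse_mat q) = of_nat q * of_nat (totient_tilde q)"
proof -
  have *: "coprime k q \<and> [int k + modular_inverse (int q) (int k) = 0] (mod int q) \<longleftrightarrow>
      int q dvd int k * int k + 1" for k
    using dvd_modular_inverse_add_iff[of "int k" "int q" "int k"]
      dvd_mult_add_1_imp_coprime[of "int q" "int k" "int k"]
    by (auto simp: cong_0_iff add.commute)
  have "mat_trace (neg_inverse_mat q)
      = (\<Sum>i<q. if int q dvd (int i + 1) * (int i + 1) + 1 then of_nat q else 0)"
    by (simp add: mat_trace_def neg_inverse_mat_def)
  also have "\<dots> = of_nat q * of_nat (card {i \<in> {..<q}. int q dvd int (Suc i) * int (Suc i) + 1})"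
    by (simp add: sum.inter_filter[symmetric] add.commute)
  also have "card {i \<in> {..<q}. int q dvd int (Suc i) * int (Suc i) + 1} = totient_tilde q"
    unfolding card_filter_lessThan_Suc[where P = "\<lambda>k. int q dvd int k * int k + 1"] totient_tilde_def * ..
  finally show ?thesis .
qed

lemma mat_trace_neg_inverse_mat_square:
  assumes q: "q > 0"
  shows "mat_trace (neg_inverse_mat q * neg_inverse_mat q) = (of_nat q)\<^sup>2 * of_nat (totient q)"
proof -
  have dim: "dim_row (neg_inverse_mat q) = q" by (simp add: neg_inverse_mat_def)
  have "mat_trace (neg_inverse_mat q * neg_inverse_mat q)
      = (\<Sum>i<q. if coprime (Suc i) q then (of_nat q)\<^sup>2 else 0)"
    unfolding mat_trace_def index_mult_mat(2) dim
    by (intro sum.cong refl) (simp add: neg_inverse_mat_square[OF q] add.commute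
      flip: coprime_int_iff del: index_mult_mat)
  also have "\<dots> = (of_nat q)\<^sup>2 * of_nat (card {i \<in> {..<q}. coprime (Suc i) q})"
    by (simp add: sum.inter_filter[symmetric])
  also have "card {i \<in> {..<q}. coprime (Suc i) q} = card {k \<in> {1..q}. coprime k q}"
    by (rule card_filter_lessThan_Suc)
  also have "{k \<in> {1..q}. coprime k q} = totatives q"
    by (auto simp: totatives_def)
  finally show ?thesis by (simp add: totient_def)
qed

theorem theorem3:
  fixes q :: nat
  assumes "q > 0"
  shows "char_poly (kloosterman_mat q) =
           [:0, 1:] ^ (q - totient q) *
           [:- of_nat q, 1:] ^ ((totient q + totient_tilde q) div 2) *
           [:of_nat q, 1:] ^ ((totient q - totient_tilde q) div 2)
       \<and> {x. eigenvalue (kloosterman_mat q) x} \<subseteq> {0, of_nat q, - of_nat q}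
       \<and> real (Polynomial.order 0 (char_poly (kloosterman_mat q)))
           = real q - real (totient q)
       \<and> real (Polynomial.order (of_nat q) (char_poly (kloosterman_mat q)))
           = (real (totient q) + real (totient_tilde q)) / 2
       \<and> real (Polynomial.order (- of_nat q) (char_poly (kloosterman_mat q)))
           = (real (totient q) - real (totient_tilde q)) / 2"
proof -
  let ?K = "kloosterman_mat q" and ?N = "neg_inverse_mat q"
  have cp: "char_poly ?K = char_poly ?N"
    by (rule char_poly_similar[OF similar_kloosterman_mat[OF assms]])
  obtain a b d where
    abd: "char_poly ?N = [:0, 1:] ^ a * [:- of_nat q, 1:] ^ b * [:of_nat q, 1:] ^ d"
      "a + b + d = q"
    and tr: "mat_trace ?N = of_nat q * (of_nat b - of_nat d)"
      "mat_trace (?N * ?N) = (of_nat q)\<^sup>2 * (of_nat b + of_nat d)"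
    using char_poly_three_eigenvalues[OF neg_inverse_mat_carrier eigenvalue_neg_inverse_mat[OF assms]]
    by metis
  \<comment> \<open>Cancelling q in the trace gives b - d; written as a sum, the identity transfers
    to natural numbers without truncated subtraction.\<close>
  have "(of_nat (totient_tilde q + d) :: complex) = of_nat b"
    using tr(1) assms by (simp add: mat_trace_neg_inverse_mat)
  hence tilde: "totient_tilde q + d = b" by (simp only: of_nat_eq_iff)
  have "(of_nat (totient q) :: complex) = of_nat (b + d)"
    using tr(2) assms by (simp add: mat_trace_neg_inverse_mat_square)
  hence tot: "totient q = b + d" by (simp only: of_nat_eq_iff)
  \<comment> \<open>Since the totients are b + d and b - d, their sum and difference are 2b and 2d:
    the halving is exact and no subtraction is truncated.\<close>
  have exps: "q - totient q = a" "(totient q + totient_tilde q) div 2 = b"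
    "(totient q - totient_tilde q) div 2 = d"
    using tilde tot abd(2) by auto
  have K: "?K \<in> carrier_mat q q" by (simp add: kloosterman_mat_def)
  \<comment> \<open>Eigenvalues are the roots of the characteristic polynomial, which the two
    similar matrices share.\<close>
  have "x \<in> {0, of_nat q, - of_nat q}" if "eigenvalue ?K x" for x
    using that eigenvalue_neg_inverse_mat[OF assms, of x]
    by (simp only: eigenvalue_root_char_poly[OF K] eigenvalue_root_char_poly[OF neg_inverse_mat_carrier] cp)
  moreover have "(of_nat q :: complex) \<noteq> 0" using assms by simp
  note order_three_roots[OF this abd(1)]
  moreover have "real q - real (totient q) = real a" "real (totient q) + real (totient_tilde q) = 2 * real b"
    "real (totient q) - real (totient_tilde q) = 2 * real d"
    using tilde tot abd(2) by auto
  ultimately show ?thesis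
    unfolding exps cp using abd(1) by auto
qed

end
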